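(* In the setting described in the context, there is a fixed-point free involution on \[ \mathcal{S}_{\{a\},\{b,c,d,e\}} \cup \mathcal{S}_{\{b\},\{a,c,d,e\}} \cup \mathcal{S}_{\{d\},\{a,b,c,e\}} \cup \mathcal{S}_{\{e\},\{a,b,c,d\}}, \] and thus \[ s_{\{a\},\{b,c,d,e\}} + s_{\{b\},\{a,c,d,e\}} + s_{\{d\},\{a,b,c,e\}} + s_{\{e\},\{a,b,c,d\}} \equiv 0 \pmod 2. \]
   Context: Let $G$ be a connected 4-regular graph and let $v,w$ be adjacent vertices of $G$ with exactly one common neighbour. Label the vertices so that $w$ is adjacent to $v,a,b,c$ and $v$ is adjacent to $w,c,d,e$, where $a,b,c,d,e$ are five distinct vertices. Let $S=G-\{v,w\}$ be the graph obtained by deleting $v,w$ and their incident edges (so $c$ has degree 2 in $S$). A spanning 2-forest of a graph is a spanning forest with exactly two connected components (trees). For a bipartition $P=P_1\cup P_2$ of $\{a,b,c,d,e\}$, a spanning 2-forest $\phi=T_1\cup T_2$ is compatible with $P$ if $T_i$ contains all vertices of $P_i$ and no vertex of the other part, for $i=1,2$. Let $\mathcal{S}_P$ be the set of ordered pairs $(\psi,\phi)$ of edge sets that partition $E(S)$ such that $\psi$ is (the edge set of) a spanning tree of $S$ and $\phi$ is a spanning 2-forest of $S$ compatible with $P$, and let $s_P=|\mathcal{S}_P|$. *)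

theory Defs
  imports Main
begin

text \<open>
  Finite undirected multigraphs. Each edge has a set of one or two ends, so parallel edges and
  loops are allowed. A simple graph is the special case in which edges are two-element sets of
  vertices and \<open>ends\<close> is the identity.
\<close>

record ('v, 'e) multigraph =
  verts :: "'v set"
  edges :: "'e set"
  ends :: "'e \<Rightarrow> 'v set"

definition finite_multigraph :: "('v, 'e) multigraph \<Rightarrow> bool" where
  "finite_multigraph G \<longleftrightarrow> finite (verts G) \<and> finite (edges G) \<and>
     (\<forall>e\<in>edges G. ends G e \<subseteq> verts G \<and> (card (ends G e) = 1 \<or> card (ends G e) = 2))"

definition adjacent :: "('v, 'e) multigraph \<Rightarrow> 'v \<Rightarrow> 'v \<Rightarrow> bool" where
  "adjacent G x y \<longleftrightarrow> (\<exists>e\<in>edges G. ends G e = {x, y})"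

definition neighbours :: "('v, 'e) multigraph \<Rightarrow> 'v \<Rightarrow> 'v set" where
  "neighbours G x = {y. adjacent G x y}"

text \<open>The second summand makes a loop count twice.\<close>

definition degree :: "('v, 'e) multigraph \<Rightarrow> 'v \<Rightarrow> nat" where
  "degree G x = card {e \<in> edges G. x \<in> ends G e} + card {e \<in> edges G. ends G e = {x}}"

definition regular :: "nat \<Rightarrow> ('v, 'e) multigraph \<Rightarrow> bool" where
  "regular k G \<longleftrightarrow> (\<forall>x\<in>verts G. degree G x = k)"

definition reachable :: "('v, 'e) multigraph \<Rightarrow> 'v \<Rightarrow> 'v \<Rightarrow> bool" where
  "reachable G = (adjacent G)\<^sup>*\<^sup>*"

definition is_connected :: "('v, 'e) multigraph \<Rightarrow> bool" where
  "is_connected G \<longleftrightarrow> verts G \<noteq> {} \<and> (\<forall>x\<in>verts G. \<forall>y\<in>verts G. reachable G x y)"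

definition components :: "('v, 'e) multigraph \<Rightarrow> 'v set set" where
  "components G = (\<lambda>x. {y \<in> verts G. reachable G x y}) ` verts G"

text \<open>
  A cycle is a closed walk \<open>xs ! 0, es ! 0, xs ! 1, es ! 1, \<dots>\<close> returning to \<open>xs ! 0\<close>, without
  repeated vertices or edges. Length 1 is a loop and length 2 a pair of parallel edges.
\<close>

definition is_cycle :: "('v, 'e) multigraph \<Rightarrow> 'v list \<Rightarrow> 'e list \<Rightarrow> bool" where
  "is_cycle G xs es \<longleftrightarrow> es \<noteq> [] \<and> length xs = length es \<and> distinct xs \<and> distinct es \<and>
     set es \<subseteq> edges G \<and>
     (\<forall>i<length es. ends G (es ! i) = {xs ! i, xs ! (Suc i mod length es)})"

definition is_forest :: "('v, 'e) multigraph \<Rightarrow> bool" where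
  "is_forest G \<longleftrightarrow> (\<nexists>xs es. is_cycle G xs es)"

definition is_tree :: "('v, 'e) multigraph \<Rightarrow> bool" where
  "is_tree G \<longleftrightarrow> is_connected G \<and> is_forest G"

definition delete_verts :: "('v, 'e) multigraph \<Rightarrow> 'v set \<Rightarrow> ('v, 'e) multigraph" where
  "delete_verts G X = G\<lparr>verts := verts G - X, edges := {e \<in> edges G. ends G e \<inter> X = {}}\<rparr>"

text \<open>Spanning subgraphs keep all vertices, so they are given by their edge sets.\<close>

definition spanning_subgraph :: "('v, 'e) multigraph \<Rightarrow> 'e set \<Rightarrow> ('v, 'e) multigraph" where
  "spanning_subgraph G F = G\<lparr>edges := F\<rparr>"

definition spanning_tree :: "('v, 'e) multigraph \<Rightarrow> 'e set \<Rightarrow> bool" where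
  "spanning_tree G F \<longleftrightarrow> F \<subseteq> edges G \<and> is_tree (spanning_subgraph G F)"

definition spanning_2_forest :: "('v, 'e) multigraph \<Rightarrow> 'e set \<Rightarrow> bool" where
  "spanning_2_forest G F \<longleftrightarrow> F \<subseteq> edges G \<and> is_forest (spanning_subgraph G F) \<and>
     card (components (spanning_subgraph G F)) = 2"

definition compatible :: "('v, 'e) multigraph \<Rightarrow> 'e set \<Rightarrow> 'v set \<Rightarrow> 'v set \<Rightarrow> bool" where
  "compatible G F P1 P2 \<longleftrightarrow>
     (\<exists>T1 T2. T1 \<noteq> T2 \<and> components (spanning_subgraph G F) = {T1, T2} \<and>
        P1 \<subseteq> T1 \<and> T1 \<inter> P2 = {} \<and> P2 \<subseteq> T2 \<and> T2 \<inter> P1 = {})"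

definition tree_forest_pairs ::
    "('v, 'e) multigraph \<Rightarrow> 'v set \<Rightarrow> 'v set \<Rightarrow> ('e set \<times> 'e set) set" where
  "tree_forest_pairs S P1 P2 =
     {(\<psi>, \<phi>). \<psi> \<union> \<phi> = edges S \<and> \<psi> \<inter> \<phi> = {} \<and>
        spanning_tree S \<psi> \<and> spanning_2_forest S \<phi> \<and> compatible S \<phi> P1 P2}"

definition num_tree_forest_pairs :: "('v, 'e) multigraph \<Rightarrow> 'v set \<Rightarrow> 'v set \<Rightarrow> nat" where
  "num_tree_forest_pairs S P1 P2 = card (tree_forest_pairs S P1 P2)"

definition fixed_point_free_involution_on :: "'a set \<Rightarrow> ('a \<Rightarrow> 'a) \<Rightarrow> bool" where
  "fixed_point_free_involution_on A f \<longleftrightarrow> (\<forall>x\<in>A. f x \<in> A \<and> f (f x) = x \<and> f x \<noteq> x)"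

end

theory Submission
  imports Defs
begin

text \<open>
  An involution without fixed points exists as soon as the number of pairs is even. In a relevant
  pair \<open>c\<close> is a leaf of both the tree and the 2-forest, so removing \<open>c\<close>, with its two neighbours \<open>x\<close>
  and \<open>y\<close> in \<open>S\<close>, leaves a partition \<open>(T, F)\<close> of the edges of \<open>S - c\<close>, and \<open>c\<close> can be reattached in two
  ways. If \<open>F\<close> separates one of \<open>a, b, d, e\<close> from the other three, then both or none of the two ways
  are relevant when \<open>F\<close> joins \<open>x\<close> to \<open>y\<close>, and exactly one is when \<open>F\<close> separates them. So only the latter
  partitions count modulo 2. Summing degrees over one side of \<open>F\<close> shows that, among the partitions
  in which \<open>F\<close> separates \<open>x\<close> from \<open>y\<close>, these are the ones with an even number of edges of \<open>T\<close> running
  between the two trees of \<open>F\<close>.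

  To see that their number is even, move such an edge \<open>g\<close> from \<open>T\<close> to \<open>F\<close>: this gives another partition
  \<open>(F + g, T - g)\<close>, and the operation is reversible. The \<open>x\<close>-\<open>y\<close> path of \<open>T\<close> contains an odd number of edges
  that cross \<open>F\<close> iff \<open>F\<close> separates \<open>x\<close> from \<open>y\<close>. Now count the moves leading from a partition that
  separates \<open>x\<close> from \<open>y\<close> to one that does not. The former partition has an odd number of such moves iff
  its total number of crossing edges is even, while each partition of the latter kind is
  reached by an even number of moves.
\<close>

section \<open>Acyclicity through bridges\<close>

text \<open>Only the end map and the edge set enter, no vertex set, so the same relation serves both
  \<open>S\<close> and \<open>S - c\<close>. Every point is connected to itself.\<close>

definition conn :: "('e \<Rightarrow> 'v set) \<Rightarrow> 'e set \<Rightarrow> 'v \<Rightarrow> 'v \<Rightarrow> bool" where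
  "conn en F = (\<lambda>p q. \<exists>e\<in>F. en e = {p, q})\<^sup>*\<^sup>*"

lemma conn_refl [simp]: "conn en F p p"
  by (simp add: conn_def)

lemma conn_trans: "conn en F p q \<Longrightarrow> conn en F q r \<Longrightarrow> conn en F p r"
  unfolding conn_def by (rule rtranclp_trans)

lemma conn_sym: "conn en F p q \<Longrightarrow> conn en F q p"
  unfolding conn_def
proof (induction rule: rtranclp_induct)
  case (step y z)
  then have "\<exists>e\<in>F. en e = {z, y}" by (metis insert_commute)
  then show ?case using step.IH by (rule converse_rtranclp_into_rtranclp)
qed simp

lemma conn_common: "conn en F p r \<Longrightarrow> conn en F q r \<Longrightarrow> conn en F p q"
  by (meson conn_sym conn_trans)

lemma conn_cong: "conn en F y z \<Longrightarrow> conn en F x y \<longleftrightarrow> conn en F x z"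
  by (meson conn_sym conn_trans)

lemma conn_edge: "g \<in> F \<Longrightarrow> en g = {p, q} \<Longrightarrow> conn en F p q"
  unfolding conn_def by (rule r_into_rtranclp) blast

lemma conn_mono: "conn en F p q \<Longrightarrow> F \<subseteq> F' \<Longrightarrow> conn en F' p q"
  unfolding conn_def by (erule rtranclp_mono[THEN predicate2D, rotated]) blast

lemma conn_step: "conn en F p q \<Longrightarrow> g \<in> F \<Longrightarrow> en g = {q, r} \<Longrightarrow> conn en F p r"
  by (meson conn_edge conn_trans)

lemma conn_induct [consumes 1, case_names refl step]:
  assumes "conn en F p q" and "P p"
    and "\<And>y z g. conn en F p y \<Longrightarrow> g \<in> F \<Longrightarrow> en g = {y, z} \<Longrightarrow> P y \<Longrightarrow> P z"
  shows "P q"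
  using assms(1) unfolding conn_def
  by (induction rule: rtranclp_induct) (use assms(2,3) in \<open>auto simp: conn_def\<close>)

text \<open>A walk through \<open>g\<close> can be shortened until it uses \<open>g\<close> at most
  once, in one of its two directions.\<close>

lemma conn_insert:
  assumes "en g = {s, t}"
  shows "conn en (insert g F) p q \<longleftrightarrow>
    conn en F p q \<or> conn en F p s \<and> conn en F t q \<or> conn en F p t \<and> conn en F s q"
    (is "?L \<longleftrightarrow> ?R q")
proof
  show "?L \<Longrightarrow> ?R q"
  proof (induction rule: conn_induct)
    case (step y z h)
    show ?case
    proof (cases "h = g")
      case True
      then have "y = s \<and> z = t \<or> y = t \<and> z = s" using step(3) assms by (auto simp: doubleton_eq_iff)
      then show ?thesis using step(4) by (metis conn_refl)
    next
      case False
      then have "conn en F y z" using step(2,3) by (intro conn_edge[of h]) auto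
      then show ?thesis using step(4) conn_trans[of en F _ y z] by blast
    qed
  qed simp
next
  assume R: "?R q"
  have st: "conn en (insert g F) s t" using assms by (intro conn_edge[of g]) auto
  have mono: "conn en F u v \<Longrightarrow> conn en (insert g F) u v" for u v
    by (rule conn_mono) auto
  from R show ?L
  proof (elim disjE conjE)
    assume "conn en F p s" "conn en F t q"
    then show ?thesis using mono st by (metis conn_trans)
  next
    assume "conn en F p t" "conn en F s q"
    then show ?thesis using mono st by (metis conn_trans conn_sym)
  qed (rule mono)
qed

text \<open>Every edge is a bridge: this is acyclicity expressed without cycles.\<close>

definition all_bridges :: "('e \<Rightarrow> 'v set) \<Rightarrow> 'e set \<Rightarrow> bool" where
  "all_bridges en F \<longleftrightarrow> (\<forall>g\<in>F. \<forall>p q. en g = {p, q} \<longrightarrow> \<not> conn en (F - {g}) p q)"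

text \<open>Needed to produce the vertex and edge lists that \<open>is_cycle\<close> asks for. When
  the walk returns to a vertex already listed, the path is cut back to that vertex.\<close>

lemma conn_path:
  assumes "conn en F p q"
  shows "\<exists>xs es. length xs = Suc (length es) \<and> distinct xs \<and> set es \<subseteq> F \<and> xs ! 0 = p \<and>
    xs ! length es = q \<and> (\<forall>i<length es. en (es ! i) = {xs ! i, xs ! Suc i})"
  using assms
proof (induction rule: conn_induct)
  case refl
  show ?case by (rule exI[of _ "[p]"], rule exI[of _ "[]"]) simp
next
  case (step y z g)
  then obtain xs es where P: "length xs = Suc (length es)" "distinct xs" "set es \<subseteq> F" "xs ! 0 = p"
    "xs ! length es = y" "\<forall>i<length es. en (es ! i) = {xs ! i, xs ! Suc i}" by blast
  show ?case
  proof (cases "z \<in> set xs")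
    case True
    then obtain k where k: "k < length xs" "xs ! k = z" by (metis in_set_conv_nth)
    show ?thesis
      using P k by (intro exI[of _ "take (Suc k) xs"] exI[of _ "take k es"])
        (auto dest: in_set_takeD)
  next
    case False
    show ?thesis
      using P False step(2,3) by (intro exI[of _ "xs @ [z]"] exI[of _ "es @ [g]"])
        (auto simp: nth_append less_Suc_eq)
  qed
qed

lemma path_edges_distinct:
  assumes "length xs = Suc (length es)" "distinct xs"
    and "\<forall>i<length es. en (es ! i) = {xs ! i, xs ! Suc i}"
  shows "distinct es"
  unfolding distinct_conv_nth
proof (intro allI impI)
  fix i j assume ij: "i < length es" "j < length es" "i \<noteq> j"
  then have "{xs ! i, xs ! Suc i} \<noteq> {xs ! j, xs ! Suc j}"
    using assms(1,2) by (auto simp: doubleton_eq_iff nth_eq_iff_index_eq)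
  then show "es ! i \<noteq> es ! j" using assms(3) ij by metis
qed

text \<open>A cycle is the same as an edge together with a path between its ends that avoids it. One
  direction closes such a path by the edge, the other opens a cycle at its last edge.\<close>

lemma is_forest_iff_all_bridges:
  "is_forest (spanning_subgraph G F) \<longleftrightarrow> all_bridges (ends G) F"
proof
  assume forest: "is_forest (spanning_subgraph G F)"
  show "all_bridges (ends G) F"
    unfolding all_bridges_def
  proof (intro ballI allI impI notI)
    fix g p q assume g: "g \<in> F" "ends G g = {p, q}" "conn (ends G) (F - {g}) p q"
    from conn_path[OF g(3)]
    obtain xs es where P: "length xs = Suc (length es)" "distinct xs" "set es \<subseteq> F - {g}" "xs ! 0 = p"
      "xs ! length es = q" "\<forall>i<length es. ends G (es ! i) = {xs ! i, xs ! Suc i}"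
      by (elim exE conjE)
    have "ends G ((es @ [g]) ! i) = {xs ! i, xs ! (Suc i mod length (es @ [g]))}"
      if "i < length (es @ [g])" for i
    proof (cases "i = length es")
      case True
      then show ?thesis using P(1,4,5) g(2) by (simp add: insert_commute)
    next
      case False
      then have "i < length es" using that by simp
      moreover have "Suc i mod Suc (length es) = Suc i" using \<open>i < length es\<close> mod_less by blast
      ultimately show ?thesis using P(6) by (simp add: nth_append)
    qed
    moreover have "distinct (es @ [g])" "set (es @ [g]) \<subseteq> F"
      using path_edges_distinct[OF P(1,2,6)] P(3) g(1) by auto
    ultimately have "is_cycle (spanning_subgraph G F) xs (es @ [g])"
      unfolding is_cycle_def spanning_subgraph_def using P(1,2) by simp
    then show False using forest unfolding is_forest_def by blast
  qed
next
  assume br: "all_bridges (ends G) F"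
  show "is_forest (spanning_subgraph G F)"
    unfolding is_forest_def
  proof (intro notI, elim exE)
    fix xs es assume cyc: "is_cycle (spanning_subgraph G F) xs es"
    \<comment> \<open>\<open>n\<close> indexes the closing edge, the only one whose next vertex
      wraps around to \<open>xs ! 0\<close>. For a loop, \<open>n = 0\<close> and the remaining path
      is trivial.\<close>
    define n where "n = length es - 1"
    have n: "length es = Suc n" using cyc by (auto simp: is_cycle_def n_def)
    have E: "distinct es" "set es \<subseteq> F"
      and ends: "\<forall>i<length es. ends G (es ! i) = {xs ! i, xs ! (Suc i mod length es)}"
      using cyc unfolding is_cycle_def spanning_subgraph_def by auto
    have inner: "ends G (es ! i) = {xs ! i, xs ! Suc i}" if "i < n" for i
      using ends[rule_format, of i] mod_less[of "Suc i" "length es"] that n by (metis Suc_mono less_Suc_eq)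
    have last: "ends G (es ! n) = {xs ! n, xs ! 0}"
      using ends[rule_format, of n] n mod_self[of "Suc n"] by (metis lessI)
    have "conn (ends G) (F - {es ! n}) (xs ! 0) (xs ! i)" if "i \<le> n" for i
      using that
    proof (induction i)
      case (Suc i)
      have "es ! i \<noteq> es ! n" using E(1) Suc(2) n by (simp add: nth_eq_iff_index_eq)
      moreover have "es ! i \<in> F" using E(2) Suc(2) n by (simp add: subset_iff)
      moreover have "ends G (es ! i) = {xs ! i, xs ! Suc i}" using inner Suc(2) by simp
      ultimately show ?case by (intro conn_step[OF Suc(1)[OF Suc_leD[OF Suc(2)]]]) auto
    qed simp
    then have "conn (ends G) (F - {es ! n}) (xs ! n) (xs ! 0)" by (simp add: conn_sym)
    moreover have "es ! n \<in> F" using E(2) n by (simp add: subset_iff)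
    ultimately show False using br last unfolding all_bridges_def by metis
  qed
qed

section \<open>Trees and 2-forests on a vertex set, and removing or adding one edge\<close>

definition tree_on :: "('e \<Rightarrow> 'v set) \<Rightarrow> 'v set \<Rightarrow> 'e set \<Rightarrow> bool" where
  "tree_on en V F \<longleftrightarrow> (\<forall>p\<in>V. \<forall>q\<in>V. conn en F p q) \<and> all_bridges en F"

text \<open>The first conjunct gives at least two components on \<open>V\<close>, the second at most
  two. This form avoids counting component sets.\<close>

definition two_forest_on :: "('e \<Rightarrow> 'v set) \<Rightarrow> 'v set \<Rightarrow> 'e set \<Rightarrow> bool" where
  "two_forest_on en V F \<longleftrightarrow> (\<exists>p\<in>V. \<exists>q\<in>V. \<not> conn en F p q) \<and>
     (\<forall>p\<in>V. \<forall>q\<in>V. \<forall>r\<in>V. conn en F p q \<or> conn en F q r \<or> conn en F p r) \<and> all_bridges en F"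

definition crosses :: "('e \<Rightarrow> 'v set) \<Rightarrow> 'e set \<Rightarrow> 'e \<Rightarrow> bool" where
  "crosses en F g \<longleftrightarrow> (\<exists>p q. en g = {p, q} \<and> \<not> conn en F p q)"

lemma crosses_iff: "en g = {s, t} \<Longrightarrow> crosses en F g \<longleftrightarrow> \<not> conn en F s t"
  unfolding crosses_def by (auto simp: doubleton_eq_iff dest: conn_sym)

lemma all_bridgesD: "all_bridges en F \<Longrightarrow> g \<in> F \<Longrightarrow> en g = {p, q} \<Longrightarrow> \<not> conn en (F - {g}) p q"
  by (simp add: all_bridges_def)

lemma all_bridges_subset: "all_bridges en F \<Longrightarrow> F' \<subseteq> F \<Longrightarrow> all_bridges en F'"
  unfolding all_bridges_def by (blast intro: conn_mono[of en "F' - _" _ _ "F - _"])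

text \<open>With \<open>g\<close> put back, \<open>p\<close> reaches both ends, so it reaches at
  least one of them without \<open>g\<close>. It cannot reach both, because \<open>g\<close> is a
  bridge.\<close>

lemma tree_on_edge_split:
  assumes "tree_on en V T" "g \<in> T" "en g = {s, t}" "s \<in> V" "p \<in> V"
  shows "conn en (T - {g}) p s \<noteq> conn en (T - {g}) p t"
proof -
  have "conn en (insert g (T - {g})) p s"
    using assms by (simp add: tree_on_def insert_absorb)
  then have "conn en (T - {g}) p s \<or> conn en (T - {g}) p t"
    by (subst (asm) conn_insert[of en, OF assms(3)]) auto
  moreover have "\<not> conn en (T - {g}) s t"
    using assms by (intro all_bridgesD) (auto simp: tree_on_def)
  ultimately show ?thesis by (metis conn_sym conn_trans)
qed

lemma tree_on_remove:
  assumes "tree_on en V T" "g \<in> T" "en g = {s, t}" "s \<in> V" "t \<in> V"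
  shows "two_forest_on en V (T - {g})"
  unfolding two_forest_on_def
proof (intro conjI)
  show "\<exists>p\<in>V. \<exists>q\<in>V. \<not> conn en (T - {g}) p q"
    using tree_on_edge_split[OF assms(1-4)] assms(4,5) by blast
  show "\<forall>p\<in>V. \<forall>q\<in>V. \<forall>r\<in>V. conn en (T - {g}) p q \<or> conn en (T - {g}) q r \<or> conn en (T - {g}) p r"
  proof (intro ballI)
    \<comment> \<open>Two of the three vertices lie on the same side of the removed edge.\<close>
    fix p q r assume "p \<in> V" "q \<in> V" "r \<in> V"
    then show "conn en (T - {g}) p q \<or> conn en (T - {g}) q r \<or> conn en (T - {g}) p r"
      using tree_on_edge_split[OF assms(1-4)] conn_common[of en "T - {g}"] by blast
  qed
  show "all_bridges en (T - {g})"
    using assms(1) all_bridges_subset unfolding tree_on_def by blast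
qed

text \<open>Each tree of \<open>F\<close> contains one end of \<open>g\<close>, so \<open>g\<close>
  joins them. An old edge \<open>h\<close> stays a bridge: a detour around it would have to use
  \<open>g\<close>, and together with \<open>h\<close> it would connect \<open>s\<close> to
  \<open>t\<close> inside \<open>F\<close>.\<close>

lemma two_forest_on_insert:
  assumes F: "two_forest_on en V F" and g: "en g = {s, t}" "s \<in> V" "t \<in> V" and st: "\<not> conn en F s t"
  shows "tree_on en V (insert g F)"
  unfolding tree_on_def
proof (intro conjI ballI)
  fix p q assume "p \<in> V" "q \<in> V"
  then have "conn en F p s \<or> conn en F p t" "conn en F q s \<or> conn en F q t"
    using F g st unfolding two_forest_on_def by blast+
  then show "conn en (insert g F) p q"
    unfolding conn_insert[of en, OF g(1)] using conn_common[of en F] conn_sym[of en F] by blast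
next
  show "all_bridges en (insert g F)"
    unfolding all_bridges_def
  proof (intro ballI allI impI notI)
    fix h p q assume h: "h \<in> insert g F" "en h = {p, q}" "conn en (insert g F - {h}) p q"
    show False
    proof (cases "h = g")
      case True
      then have "conn en F p q" using h(3) by (auto elim: conn_mono)
      then show False using True h(2) g(1) st by (metis conn_sym doubleton_eq_iff)
    next
      case False
      then have hF: "h \<in> F" and eq: "insert g F - {h} = insert g (F - {h})" using h(1) by auto
      have "\<not> conn en (F - {h}) p q"
        using F hF h(2) by (auto simp: two_forest_on_def all_bridges_def)
      then have "conn en (F - {h}) p s \<and> conn en (F - {h}) t q \<or> conn en (F - {h}) p t \<and> conn en (F - {h}) s q"
        using h(3) unfolding eq conn_insert[of en, OF g(1)] by blast
      then have "conn en F p s \<and> conn en F t q \<or> conn en F p t \<and> conn en F s q"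
        by (meson conn_mono Diff_subset)
      moreover have "conn en F p q" using hF h(2) by (rule conn_edge)
      ultimately show False using st conn_trans[of en F] conn_sym[of en F] by blast
    qed
  qed
qed

section \<open>Exchanging an edge between a tree and a 2-forest\<close>

text \<open>For an edge with ends \<open>s\<close> and \<open>t\<close> this says that exactly one
  of them is in \<open>A\<close>; a loop never cuts.\<close>

definition cuts :: "('e \<Rightarrow> 'v set) \<Rightarrow> 'v set \<Rightarrow> 'e \<Rightarrow> bool" where
  "cuts en A g \<longleftrightarrow> \<not> en g \<subseteq> A \<and> en g \<inter> A \<noteq> {}"

lemma odd_card_differ:
  assumes "finite A" "finite B" "A - {k} = B - {k}" "(k \<in> A) \<noteq> (k \<in> B)"
  shows "odd (card A) \<noteq> odd (card B)"
proof -
  have "A = insert k B \<and> k \<notin> B \<or> B = insert k A \<and> k \<notin> A"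
    using assms(3,4) by (metis Diff_empty Diff_insert0 insert_Diff)
  then have "card A = Suc (card B) \<or> card B = Suc (card A)"
    using card_insert_disjoint assms(1,2) by metis
  then show ?thesis by (elim disjE) simp_all
qed

text \<open>The edges whose removal from \<open>T\<close> separates \<open>x\<close> from
  \<open>y\<close> form the \<open>x\<close>-\<open>y\<close> path of \<open>T\<close>. This path
  changes sides of \<open>A\<close> an odd number of times iff its ends are on different
  sides.\<close>

lemma odd_card_tree_path_cut:
  assumes T: "tree_on en V T" "finite T" and V: "\<And>g. g \<in> T \<Longrightarrow> en g \<subseteq> V" "x \<in> V" "y \<in> V"
  shows "odd (card {g \<in> T. \<not> conn en (T - {g}) x y \<and> cuts en A g}) \<longleftrightarrow> (x \<in> A) \<noteq> (y \<in> A)"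
proof -
  have "conn en T x y" using T V by (simp add: tree_on_def)
  then show ?thesis
  proof (induction rule: conn_induct)
    case (step y z k)
    let ?S = "\<lambda>z. {g \<in> T. \<not> conn en (T - {g}) x z \<and> cuts en A g}"
    have fin: "finite (?S y)" "finite (?S z)" using T(2) by auto
    have other: "conn en (T - {g}) x y = conn en (T - {g}) x z" if "g \<noteq> k" for g
    proof -
      have "conn en (T - {g}) y z" using step that by (intro conn_edge[of k]) auto
      then show ?thesis by (rule conn_cong)
    qed
    \<comment> \<open>Moving the endpoint along \<open>k\<close> toggles the membership of
      \<open>k\<close> in the path and, by \<open>other\<close>, of no other edge; a walk that goes
      back over \<open>k\<close> removes it again.\<close>
    have k: "conn en (T - {k}) x y \<noteq> conn en (T - {k}) x z"
      using tree_on_edge_split[OF T(1) step(2,3) _ V(2)] V(1)[OF step(2)] step(3) by simp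
    have cut: "cuts en A k \<longleftrightarrow> (y \<in> A) \<noteq> (z \<in> A)" using step(3) by (auto simp: cuts_def)
    show ?case
    proof (cases "cuts en A k")
      case False
      have "?S y = ?S z"
      proof (rule set_eqI)
        show "g \<in> ?S y \<longleftrightarrow> g \<in> ?S z" for g using other[of g] False by (cases "g = k") simp_all
      qed
      then show ?thesis using step(4) cut False by simp
    next
      case True
      have "?S y - {k} = ?S z - {k}"
      proof (rule set_eqI)
        show "g \<in> ?S y - {k} \<longleftrightarrow> g \<in> ?S z - {k}" for g using other[of g] by (cases "g = k") simp_all
      qed
      moreover have "(k \<in> ?S y) \<noteq> (k \<in> ?S z)" using k True step(2) by simp
      ultimately have "odd (card (?S y)) \<noteq> odd (card (?S z))" by (rule odd_card_differ[OF fin])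
      then show ?thesis using step(4) cut True by blast
    qed
  qed simp
qed

definition tree_forest_partitions ::
    "('e \<Rightarrow> 'v set) \<Rightarrow> 'v set \<Rightarrow> 'e set \<Rightarrow> ('e set \<times> 'e set) set" where
  "tree_forest_partitions en V E =
     {(T, F). T \<union> F = E \<and> T \<inter> F = {} \<and> tree_on en V T \<and> two_forest_on en V F}"

lemma finite_tree_forest_partitions: "finite E \<Longrightarrow> finite (tree_forest_partitions en V E)"
  by (rule finite_subset[of _ "Pow E \<times> Pow E"]) (auto simp: tree_forest_partitions_def)

text \<open>The moved edge joins the two trees of \<open>F\<close> and is a bridge of
  \<open>T\<close>. The second claim makes the same move available in the opposite
  direction.\<close>

lemma tree_forest_partitions_exchange:
  assumes "(T, F) \<in> tree_forest_partitions en V E" and "en g \<subseteq> V" and "g \<in> T" and "crosses en F g"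
  shows "(insert g F, T - {g}) \<in> tree_forest_partitions en V E" and "crosses en (T - {g}) g"
proof -
  obtain s t where st: "en g = {s, t}" "\<not> conn en F s t" using assms(4) by (auto simp: crosses_def)
  have P: "T \<union> F = E" "T \<inter> F = {}" "tree_on en V T" "two_forest_on en V F"
    using assms(1) by (auto simp: tree_forest_partitions_def)
  have "tree_on en V (insert g F)" "two_forest_on en V (T - {g})"
    using two_forest_on_insert[OF P(4) st(1)] tree_on_remove[OF P(3) assms(3) st(1)] assms(2) st by auto
  then show "(insert g F, T - {g}) \<in> tree_forest_partitions en V E"
    using P assms(3) by (auto simp: tree_forest_partitions_def)
  show "crosses en (T - {g}) g"
    using P(3) assms(3) st(1) unfolding crosses_def tree_on_def all_bridges_def by blast
qed

text \<open>Since there are only two components, an edge runs between them iff it leaves the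
  component of \<open>x\<close>.\<close>

lemma crosses_iff_cuts:
  assumes F: "two_forest_on en V F" and x: "x \<in> V" and g: "en g = {s, t}" "en g \<subseteq> V"
  shows "crosses en F g \<longleftrightarrow> cuts en {u \<in> V. conn en F x u} g"
proof -
  have "s \<in> V" "t \<in> V" using g by auto
  moreover have "conn en F x s \<or> conn en F s t \<or> conn en F x t"
    using F x calculation unfolding two_forest_on_def by blast
  ultimately show ?thesis
    using conn_trans[of en F x s t] conn_trans[of en F x t s] conn_trans[of en F s x t]
      conn_sym[of en F x s] conn_sym[of en F s t] x
    unfolding crosses_iff[of en, OF g(1)] cuts_def g(1) by auto
qed

lemma even_separating_partitions:
  fixes en :: "'e \<Rightarrow> 'v set"
  assumes E: "finite E" "\<And>g. g \<in> E \<Longrightarrow> en g \<subseteq> V" "\<And>g. g \<in> E \<Longrightarrow> \<exists>s t. en g = {s, t}"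
    and xy: "x \<in> V" "y \<in> V"
  shows "even (card {(T, F) \<in> tree_forest_partitions en V E.
    \<not> conn en F x y \<and> even (card {g \<in> T. crosses en F g})})"
proof -
  let ?D = "tree_forest_partitions en V E"
  define D1 where "D1 = {p \<in> ?D. \<not> conn en (snd p) x y}"
  define D0 where "D0 = {p \<in> ?D. conn en (snd p) x y}"
  \<comment> \<open>The crossing edges of the tree are sorted by whether they lie off or on its
    \<open>x\<close>-\<open>y\<close> path.\<close>
  define off where "off = (\<lambda>p. {g \<in> fst p. crosses en (snd p) g \<and> conn en (fst p - {g}) x y})"
  define on where "on = (\<lambda>p. {g \<in> fst p. crosses en (snd p) g \<and> \<not> conn en (fst p - {g}) x y})"
  have fin: "finite D1" "finite D0"
    using finite_tree_forest_partitions[OF E(1), of en V] by (auto simp: D1_def D0_def)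
  have fin_T: "finite (fst p)" if "p \<in> ?D" for p
    using that E(1) by (auto simp: tree_forest_partitions_def intro: finite_subset)
  have fin_off: "finite (off p)" and fin_on: "finite (on p)" if "p \<in> ?D" for p
    using fin_T[OF that] by (auto simp: off_def on_def)
  have odd_on: "odd (card (on p)) \<longleftrightarrow> \<not> conn en (snd p) x y" if p: "p \<in> ?D" for p
  proof -
    obtain T F where TF: "p = (T, F)" by force
    have P: "T \<subseteq> E" "tree_on en V T" "two_forest_on en V F"
      using p TF by (auto simp: tree_forest_partitions_def)
    have "crosses en F g \<longleftrightarrow> cuts en {u \<in> V. conn en F x u} g" if g: "g \<in> T" for g
    proof -
      from g P(1) have "g \<in> E" by auto
      then show ?thesis using E(3)[of g] crosses_iff_cuts[OF P(3) xy(1) _ E(2)] by metis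
    qed
    then have "on p = {g \<in> T. \<not> conn en (T - {g}) x y \<and> cuts en {u \<in> V. conn en F x u} g}"
      unfolding on_def TF by auto
    then show ?thesis
      using odd_card_tree_path_cut[OF P(2), of x y "{u \<in> V. conn en F x u}"] fin_T[OF p] P(1) E xy TF
      by auto
  qed
  \<comment> \<open>Moving \<open>g\<close> makes \<open>T - {g}\<close> the new 2-forest, which
    joins \<open>x\<close> to \<open>y\<close> iff \<open>g\<close> was off the path. In the new
    tree \<open>g\<close> is on the path iff the old \<open>F\<close> separated \<open>x\<close>
    from \<open>y\<close>. Hence the move, its own inverse, matches \<open>off\<close> over
    \<open>D1\<close> with \<open>on\<close> over \<open>D0\<close>.\<close>
  let ?ex = "\<lambda>((T, F), g). ((insert g F, T - {g}), g)"
  have "bij_betw ?ex (Sigma D1 off) (Sigma D0 on)"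
  proof (rule bij_betw_byWitness[where f' = ?ex])
    show "\<forall>z\<in>Sigma D1 off. ?ex (?ex z) = z" "\<forall>z\<in>Sigma D0 on. ?ex (?ex z) = z"
      by (auto simp: D1_def D0_def off_def on_def tree_forest_partitions_def)
    have D: "(insert g F, T - {g}) \<in> ?D \<and> crosses en (T - {g}) g \<and> insert g F - {g} = F"
      if "(T, F) \<in> ?D" "g \<in> T" "crosses en F g" for T F g
    proof -
      have "g \<in> E" "g \<notin> F" using that by (auto simp: tree_forest_partitions_def)
      then show ?thesis using tree_forest_partitions_exchange[OF that(1) E(2) that(2,3)] by auto
    qed
    show "?ex ` Sigma D1 off \<subseteq> Sigma D0 on" "?ex ` Sigma D0 on \<subseteq> Sigma D1 off"
      using D by (auto simp: D1_def D0_def off_def on_def)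
  qed
  then have "card (Sigma D1 off) = card (Sigma D0 on)" by (rule bij_betw_same_card)
  also have "\<dots> = (\<Sum>p\<in>D0. card (on p))"
    using fin fin_on by (intro card_SigmaI) (auto simp: D0_def)
  also have "even \<dots>"
    using odd_on by (intro dvd_sum) (auto simp: D0_def)
  finally have "even (\<Sum>p\<in>D1. card (off p))"
    using fin fin_off by (subst (asm) card_SigmaI) (auto simp: D1_def)
  \<comment> \<open>An even sum has an even number of odd terms.\<close>
  then have "even (card {p \<in> D1. odd (card (off p))})"
    by (simp only: even_sum_iff[OF fin(1)])
  \<comment> \<open>On \<open>D1\<close> the number of crossing edges on the path is odd, so the
    total has the opposite parity to the number off the path.\<close>
  also have "{p \<in> D1. odd (card (off p))} = {p \<in> D1. even (card {g \<in> fst p. crosses en (snd p) g})}"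
  proof -
    have "odd (card (off p)) \<longleftrightarrow> even (card {g \<in> fst p. crosses en (snd p) g})" if "p \<in> D1" for p
    proof -
      have p: "p \<in> ?D" "\<not> conn en (snd p) x y" using that by (auto simp: D1_def)
      have "{g \<in> fst p. crosses en (snd p) g} = off p \<union> on p" by (auto simp: off_def on_def)
      moreover have "card (off p \<union> on p) = card (off p) + card (on p)"
        using fin_off fin_on p by (intro card_Un_disjoint) (auto simp: off_def on_def)
      ultimately show ?thesis using odd_on p by simp
    qed
    then show ?thesis by blast
  qed
  also have "\<dots> = {(T, F) \<in> ?D. \<not> conn en F x y \<and> even (card {g \<in> T. crosses en F g})}"
    by (auto simp: D1_def)
  finally show ?thesis .
qed

section \<open>Attaching a leaf, degrees and components\<close>

lemma conn_isolated:
  assumes "c \<notin> \<Union> (en ` F)"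
  shows "conn en F c q \<longleftrightarrow> q = c" "conn en F q c \<longleftrightarrow> q = c"
proof -
  have "conn en F c q \<Longrightarrow> q = c" for q
  proof (induction rule: conn_induct)
    case (step y z g)
    then show ?case using assms by auto
  qed simp
  then show "conn en F c q \<longleftrightarrow> q = c" "conn en F q c \<longleftrightarrow> q = c"
    using conn_sym[of en F q c] by auto
qed

lemma conn_imp_incident_edge:
  assumes "conn en F c q" "q \<noteq> c"
  shows "\<exists>g\<in>F. \<exists>x. en g = {c, x} \<and> x \<noteq> c"
proof -
  have "q = c \<or> (\<exists>g\<in>F. \<exists>x. en g = {c, x} \<and> x \<noteq> c)"
    using assms(1)
  proof (induction rule: conn_induct)
    case (step y z g)
    then show ?case by (cases "y = c"; cases "z = c") auto
  qed simp
  then show ?thesis using assms(2) by simp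
qed

text \<open>A leaf is connected to exactly what its neighbour is connected to, so \<open>c\<close>
  may be replaced by \<open>x\<close> throughout.\<close>

lemma conn_attach_leaf:
  assumes F: "c \<notin> \<Union> (en ` F)" and k: "en k = {c, x}" "x \<noteq> c"
  shows "conn en (insert k F) p q \<longleftrightarrow> conn en F (if p = c then x else p) (if q = c then x else q)"
  unfolding conn_insert[of en, OF k(1)] using conn_isolated[OF F] k(2) by auto

lemma all_bridges_attach_leaf:
  assumes F: "c \<notin> \<Union> (en ` F)" and k: "en k = {c, x}" "x \<noteq> c"
  shows "all_bridges en (insert k F) \<longleftrightarrow> all_bridges en F"
proof
  show "all_bridges en (insert k F) \<Longrightarrow> all_bridges en F" by (rule all_bridges_subset) auto
next
  assume br: "all_bridges en F"
  show "all_bridges en (insert k F)"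
    unfolding all_bridges_def
  proof (intro ballI allI impI)
    fix g p q assume g: "g \<in> insert k F" "en g = {p, q}"
    have kF: "k \<notin> F" using F k by auto
    show "\<not> conn en (insert k F - {g}) p q"
    proof (cases "g = k")
      case True
      then have "{p, q} = {c, x}" using g(2) k(1) by simp
      then have "p = c \<and> q = x \<or> p = x \<and> q = c" by (simp add: doubleton_eq_iff)
      moreover have "insert k F - {g} = F" using True kF by auto
      ultimately show ?thesis using conn_isolated[OF F] k(2) by auto
    next
      case False
      then have gF: "g \<in> F" and eq: "insert k F - {g} = insert k (F - {g})" using g(1) by auto
      have F': "c \<notin> \<Union> (en ` (F - {g}))" using F by blast
      have "p \<noteq> c" "q \<noteq> c" using F gF g(2) by auto
      then show ?thesis
        using all_bridgesD[OF br gF g(2)] unfolding eq conn_attach_leaf[OF F' k] by simp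
    qed
  qed
qed

lemma tree_on_attach_leaf:
  assumes F: "c \<notin> \<Union> (en ` F)" and k: "en k = {c, x}" "x \<noteq> c" and V: "x \<in> V" "c \<notin> V"
  shows "tree_on en (insert c V) (insert k F) \<longleftrightarrow> tree_on en V F"
proof -
  \<comment> \<open>\<open>?m\<close> contracts the leaf onto its neighbour and maps the larger
    vertex set onto \<open>V\<close>, so quantifiers transfer along it.\<close>
  let ?m = "\<lambda>u. if u = c then x else u"
  have im: "?m ` insert c V = V" using V by auto
  have "(\<forall>p\<in>insert c V. \<forall>q\<in>insert c V. conn en F (?m p) (?m q)) \<longleftrightarrow>
      (\<forall>p\<in>?m ` insert c V. \<forall>q\<in>?m ` insert c V. conn en F p q)"
    by (simp only: ball_simps)
  then show ?thesis
    unfolding tree_on_def all_bridges_attach_leaf[OF F k] conn_attach_leaf[OF F k] im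
    by (simp only:)
qed

lemma two_forest_on_attach_leaf:
  assumes F: "c \<notin> \<Union> (en ` F)" and k: "en k = {c, x}" "x \<noteq> c" and V: "x \<in> V" "c \<notin> V"
  shows "two_forest_on en (insert c V) (insert k F) \<longleftrightarrow> two_forest_on en V F"
proof -
  let ?m = "\<lambda>u. if u = c then x else u"
  have im: "?m ` insert c V = V" using V by auto
  have "(\<exists>p\<in>insert c V. \<exists>q\<in>insert c V. \<not> conn en F (?m p) (?m q)) \<longleftrightarrow>
      (\<exists>p\<in>?m ` insert c V. \<exists>q\<in>?m ` insert c V. \<not> conn en F p q)"
    by (simp only: bex_simps)
  moreover have "(\<forall>p\<in>insert c V. \<forall>q\<in>insert c V. \<forall>r\<in>insert c V.
        conn en F (?m p) (?m q) \<or> conn en F (?m q) (?m r) \<or> conn en F (?m p) (?m r)) \<longleftrightarrow>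
      (\<forall>p\<in>?m ` insert c V. \<forall>q\<in>?m ` insert c V. \<forall>r\<in>?m ` insert c V.
        conn en F p q \<or> conn en F q r \<or> conn en F p r)"
    by (simp only: ball_simps)
  ultimately show ?thesis
    unfolding two_forest_on_def all_bridges_attach_leaf[OF F k]
      conn_attach_leaf[OF F k] im
    by (simp only:)
qed

text \<open>Adding \<open>k\<close> to the tree and \<open>l\<close> to the 2-forest is a bijection,
  undone by deleting them. The other way of attaching \<open>c\<close> is the instance with the two
  edges exchanged.\<close>

lemma card_partitions_attach_leaf:
  assumes E: "c \<notin> \<Union> (en ` E)" and V: "c \<notin> V" "x \<in> V" "y \<in> V"
    and k: "en k = {c, x}" and l: "en l = {c, y}" "k \<noteq> l"
  shows "card {(T, F) \<in> tree_forest_partitions en (insert c V) (insert k (insert l E)).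
      k \<in> T \<and> l \<in> F \<and> P F} = card {(T, F) \<in> tree_forest_partitions en V E. P (insert l F)}"
    (is "card ?A = card ?B")
proof -
  let ?f = "\<lambda>(T, F). (insert k T, insert l F)" and ?g = "\<lambda>(T, F). (T - {k}, F - {l})"
  have neq: "x \<noteq> c" "y \<noteq> c" using V by auto
  have notin: "k \<notin> E" "l \<notin> E" using E k l by auto
  have mem: "(insert k T, insert l F) \<in> tree_forest_partitions en (insert c V) (insert k (insert l E)) \<longleftrightarrow>
      (T, F) \<in> tree_forest_partitions en V E" if "T \<subseteq> E" "F \<subseteq> E" for T F
  proof -
    have "c \<notin> \<Union> (en ` T)" "c \<notin> \<Union> (en ` F)" using E that by auto
    then have "tree_on en (insert c V) (insert k T) \<longleftrightarrow> tree_on en V T"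
      "two_forest_on en (insert c V) (insert l F) \<longleftrightarrow> two_forest_on en V F"
      using tree_on_attach_leaf[of c en T k x V] two_forest_on_attach_leaf[of c en F l y V] k l V neq
      by blast+
    moreover have "insert k T \<union> insert l F = insert k (insert l E) \<longleftrightarrow> T \<union> F = E"
      "insert k T \<inter> insert l F = {} \<longleftrightarrow> T \<inter> F = {}"
      using that notin l(2) by auto
    ultimately show ?thesis by (simp only: tree_forest_partitions_def mem_Collect_eq prod.case)
  qed
  have sub: "T \<subseteq> E \<and> F \<subseteq> E" if "(T, F) \<in> tree_forest_partitions en V E" for T F
    using that unfolding tree_forest_partitions_def by blast
  have "bij_betw ?f ?B ?A"
  proof (rule bij_betw_byWitness[where f' = ?g])
    show "\<forall>p\<in>?B. ?g (?f p) = p" using sub notin by fastforce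
    show "\<forall>p\<in>?A. ?f (?g p) = p" by (auto simp: insert_absorb)
    show "?f ` ?B \<subseteq> ?A" using sub mem by auto
    show "?g ` ?A \<subseteq> ?B"
    proof clarify
      fix T F assume TF: "(T, F) \<in> tree_forest_partitions en (insert c V) (insert k (insert l E))"
        "k \<in> T" "l \<in> F" "P F"
      have "T - {k} \<subseteq> E" "F - {l} \<subseteq> E"
        using TF(1-3) unfolding tree_forest_partitions_def by blast+
      from mem[OF this] TF show "(T - {k}, F - {l}) \<in> tree_forest_partitions en V E \<and> P (insert l (F - {l}))"
        by (simp add: insert_absorb)
    qed
  qed
  then show ?thesis by (rule bij_betw_same_card[symmetric])
qed

section \<open>Parity of edge cuts and the star of a vertex\<close>

text \<open>Handshake count over \<open>A\<close>: an edge contributes its number of ends in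
  \<open>A\<close>, with a loop counted twice, and this is odd exactly when the edge cuts
  \<open>A\<close>.\<close>

lemma even_card_cut:
  assumes G: "finite_multigraph G" and deg: "\<And>u. u \<in> A \<Longrightarrow> even (degree G u)" and A: "A \<subseteq> verts G"
  shows "even (card {g \<in> edges G. cuts (ends G) A g})"
proof -
  have fin: "finite A" "finite (edges G)" using G A finite_subset by (auto simp: finite_multigraph_def)
  let ?n = "\<lambda>g. card {u \<in> A. u \<in> ends G g} + card {u \<in> A. ends G g = {u}}"
  have "(\<Sum>u\<in>A. degree G u) = (\<Sum>g\<in>edges G. ?n g)"
    unfolding degree_def sum.distrib using fin
    by (intro arg_cong2[where f = "(+)"] sum_multicount_gen) auto
  moreover have "even (\<Sum>u\<in>A. degree G u)" using deg by (intro dvd_sum) auto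
  ultimately have "even (card {g \<in> edges G. odd (?n g)})"
    by (simp only: even_sum_iff[OF fin(2)])
  also have "{g \<in> edges G. odd (?n g)} = {g \<in> edges G. cuts (ends G) A g}"
  proof (intro Collect_cong conj_cong refl)
    fix g assume "g \<in> edges G"
    then have "card (ends G g) = 1 \<or> card (ends G g) = 2" using G by (auto simp: finite_multigraph_def)
    then consider s where "ends G g = {s}" | s t where "ends G g = {s, t}" "s \<noteq> t"
      by (auto simp: card_1_singleton_iff card_2_iff)
    then show "odd (?n g) \<longleftrightarrow> cuts (ends G) A g"
    proof cases
      case 1
      then have "{u \<in> A. u \<in> ends G g} = {u \<in> A. ends G g = {u}}" by auto
      then show ?thesis using 1 by (simp add: cuts_def)
    next
      case 2
      then have none: "{u \<in> A. ends G g = {u}} = {}" and both: "{u \<in> A. u \<in> ends G g} = {s, t} \<inter> A"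
        by auto
      have "?n g = card ({s, t} \<inter> A)" unfolding none both by simp
      then show ?thesis
        using 2 by (cases "s \<in> A"; cases "t \<in> A") (simp_all only: cuts_def Int_insert_left, simp_all)
    qed
  qed
  finally show ?thesis .
qed

text \<open>One edge to each neighbour already exhausts the degree, so no parallel edge or loop is
  left and the neighbours index the edges at \<open>u\<close>.\<close>

lemma simple_star:
  assumes G: "finite_multigraph G" and deg: "degree G u = card (neighbours G u)" and loop: "u \<notin> neighbours G u"
  obtains h where "bij_betw h (neighbours G u) {g \<in> edges G. u \<in> ends G g}"
    and "\<And>z. z \<in> neighbours G u \<Longrightarrow> ends G (h z) = {u, z}"
proof -
  let ?I = "{g \<in> edges G. u \<in> ends G g}"
  have "\<forall>z\<in>neighbours G u. \<exists>g. g \<in> edges G \<and> ends G g = {u, z}"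
    by (auto simp: neighbours_def adjacent_def)
  then obtain h where h: "\<And>z. z \<in> neighbours G u \<Longrightarrow> h z \<in> edges G \<and> ends G (h z) = {u, z}"
    by metis
  have inj: "inj_on h (neighbours G u)"
  proof (rule inj_onI)
    fix z z' assume z: "z \<in> neighbours G u" "z' \<in> neighbours G u" "h z = h z'"
    then have "{u, z} = {u, z'}" using h by metis
    then show "z = z'" by (auto simp: doubleton_eq_iff)
  qed
  have fin: "finite ?I" using G by (simp add: finite_multigraph_def)
  have "h ` neighbours G u \<subseteq> ?I" using h by auto
  moreover have "card ?I \<le> card (h ` neighbours G u)"
    using deg card_image[OF inj] by (simp add: degree_def)
  ultimately have "h ` neighbours G u = ?I" using fin by (intro card_seteq)
  then show ?thesis using that inj h by (simp add: bij_betw_def)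
qed

section \<open>Spanning trees, spanning 2-forests and compatibility in terms of connectivity\<close>

lemma reachable_spanning_subgraph: "reachable (spanning_subgraph G F) = conn (ends G) F"
proof -
  have "adjacent (spanning_subgraph G F) = (\<lambda>p q. \<exists>e\<in>F. ends G e = {p, q})"
    by (intro ext) (simp add: adjacent_def spanning_subgraph_def)
  then show ?thesis by (simp add: reachable_def conn_def)
qed

lemma components_spanning_subgraph:
  "components (spanning_subgraph G F) = (\<lambda>x. {y \<in> verts G. conn (ends G) F x y}) ` verts G"
  by (simp add: components_def reachable_spanning_subgraph) (simp add: spanning_subgraph_def)

lemma component_eq_iff:
  assumes "p \<in> V" "q \<in> V"
  shows "{y \<in> V. conn en F p y} = {y \<in> V. conn en F q y} \<longleftrightarrow> conn en F p q"
proof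
  assume eq: "{y \<in> V. conn en F p y} = {y \<in> V. conn en F q y}"
  have "q \<in> {y \<in> V. conn en F q y}" using assms by simp
  then have "q \<in> {y \<in> V. conn en F p y}" unfolding eq .
  then show "conn en F p q" by simp
next
  assume "conn en F p q"
  then have "conn en F p y \<longleftrightarrow> conn en F q y" for y
    using conn_sym[of en F] conn_trans[of en F p q y] conn_trans[of en F q p y] by blast
  then show "{y \<in> V. conn en F p y} = {y \<in> V. conn en F q y}" by simp
qed

text \<open>Used with \<open>f\<close> sending a vertex to its component, which yields the two
  counting conjuncts of \<open>two_forest_on\<close>.\<close>

lemma card_image_eq_2_iff:
  "card (f ` V) = 2 \<longleftrightarrow>
    (\<exists>p\<in>V. \<exists>q\<in>V. f p \<noteq> f q) \<and> (\<forall>p\<in>V. \<forall>q\<in>V. \<forall>r\<in>V. f p = f q \<or> f q = f r \<or> f p = f r)"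
    (is "?L \<longleftrightarrow> ?R")
proof
  assume ?L
  then obtain X Y where XY: "f ` V = {X, Y}" "X \<noteq> Y" by (auto simp: card_2_iff)
  then obtain p q where "p \<in> V" "q \<in> V" "f p = X" "f q = Y"
    by (metis imageE insertI1 insertI2 singletonI)
  moreover have "f r = X \<or> f r = Y" if "r \<in> V" for r using XY(1) that by auto
  ultimately show ?R using XY(2) by metis
next
  assume R: ?R
  then obtain p q where pq: "p \<in> V" "q \<in> V" "f p \<noteq> f q" by blast
  then have "f r = f p \<or> f r = f q" if "r \<in> V" for r using R that by metis
  then have "f ` V = {f p, f q}" using pq by auto
  then show ?L using pq(3) by simp
qed

lemma spanning_2_forest_iff:
  "spanning_2_forest G F \<longleftrightarrow> F \<subseteq> edges G \<and> two_forest_on (ends G) (verts G) F"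
  unfolding spanning_2_forest_def two_forest_on_def is_forest_iff_all_bridges
    components_spanning_subgraph card_image_eq_2_iff
  by (auto simp: component_eq_iff)

lemma spanning_tree_iff:
  assumes "verts G \<noteq> {}"
  shows "spanning_tree G F \<longleftrightarrow> F \<subseteq> edges G \<and> tree_on (ends G) (verts G) F"
  using assms
  unfolding spanning_tree_def is_tree_def is_connected_def is_forest_iff_all_bridges tree_on_def
    reachable_spanning_subgraph
  by (simp add: spanning_subgraph_def)

text \<open>With two components, everything separated from \<open>z\<close> lies in the same other
  one. An element of the nonempty \<open>Q\<close> represents that component.\<close>

lemma compatible_iff:
  assumes F: "two_forest_on (ends G) (verts G) F" and z: "z \<in> verts G" and Q: "Q \<subseteq> verts G" "Q \<noteq> {}"
  shows "compatible G F {z} Q \<longleftrightarrow> (\<forall>q\<in>Q. \<not> conn (ends G) F z q)"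
proof -
  let ?C = "\<lambda>x. {y \<in> verts G. conn (ends G) F x y}"
  have comps: "components (spanning_subgraph G F) = ?C ` verts G"
    by (rule components_spanning_subgraph)
  show ?thesis
  proof
    assume "compatible G F {z} Q"
    then obtain T1 T2 where T: "components (spanning_subgraph G F) = {T1, T2}" "z \<in> T1" "T1 \<inter> Q = {}"
      unfolding compatible_def by auto
    from T(1) have "T1 \<in> ?C ` verts G" unfolding comps by simp
    then obtain u where u: "T1 = ?C u" by (elim imageE)
    show "\<forall>q\<in>Q. \<not> conn (ends G) F z q"
    proof (intro ballI notI)
      fix q assume q: "q \<in> Q" "conn (ends G) F z q"
      have "conn (ends G) F u z" using T(2) u by simp
      then have "conn (ends G) F u q" using q(2) by (rule conn_trans)
      then show False using T(3) u q(1) Q(1) by auto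
    qed
  next
    assume sep: "\<forall>q\<in>Q. \<not> conn (ends G) F z q"
    obtain q where q: "q \<in> Q" using Q(2) by auto
    have zq: "z \<in> verts G" "q \<in> verts G" "\<not> conn (ends G) F z q" using z q Q(1) sep by auto
    have near: "conn (ends G) F z r \<or> conn (ends G) F q r" if "r \<in> verts G" for r
      using F that zq unfolding two_forest_on_def by blast
    have "?C z \<noteq> ?C q" using zq component_eq_iff by metis
    moreover have "?C ` verts G = {?C z, ?C q}"
    proof (intro subset_antisym image_subsetI)
      fix r assume r: "r \<in> verts G"
      from near[OF r] show "?C r \<in> {?C z, ?C q}"
        using component_eq_iff[OF zq(1) r, of "ends G" F] component_eq_iff[OF zq(2) r, of "ends G" F]
        by (elim disjE) simp_all
    qed (use zq(1,2) in simp)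
    moreover have "Q \<subseteq> ?C q" using near sep Q(1) by blast
    moreover have "?C z \<inter> Q = {}" using sep by blast
    moreover have "z \<notin> ?C q" using zq(3) conn_sym[of "ends G" F q z] by blast
    ultimately show "compatible G F {z} Q"
      unfolding compatible_def comps using z by (intro exI[of _ "?C z"] exI[of _ "?C q"]) simp
  qed
qed

lemma tree_forest_pairs_eq:
  assumes "z \<in> verts S" "Q \<subseteq> verts S" "Q \<noteq> {}"
  shows "tree_forest_pairs S {z} Q =
    {(\<psi>, \<phi>) \<in> tree_forest_partitions (ends S) (verts S) (edges S). \<forall>q\<in>Q. \<not> conn (ends S) \<phi> z q}"
proof -
  have "verts S \<noteq> {}" using assms(1) by auto
  then show ?thesis
    unfolding tree_forest_pairs_def tree_forest_partitions_def spanning_2_forest_iff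
    using spanning_tree_iff[of S] compatible_iff[of S _ z Q] assms by auto
qed

text \<open>The set is cut into two halves, which a bijection between them and its inverse
  exchange.\<close>

lemma fixed_point_free_involution_if_even:
  assumes "finite A" "even (card A)"
  shows "\<exists>f. fixed_point_free_involution_on A f"
proof -
  obtain B where B: "B \<subseteq> A" "card B = card A div 2" "finite B"
    by (rule obtain_subset_with_card_n[of "card A div 2" A]) auto
  have "card (A - B) = card B" using B assms by (simp add: card_Diff_subset) presburger
  then obtain h where h: "bij_betw h B (A - B)"
    using finite_same_card_bij[of B "A - B"] B(3) assms(1) by auto
  define f where "f = (\<lambda>x. if x \<in> B then h x else inv_into B h x)"
  have 1: "h x \<in> A - B" "inv_into B h (h x) = x" if "x \<in> B" for x
    using h that by (auto simp: bij_betw_def)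
  have 2: "inv_into B h x \<in> B" "h (inv_into B h x) = x" if "x \<in> A - B" for x
    using h that by (auto simp: bij_betw_def inv_into_into f_inv_into_f)
  have "f x \<in> A \<and> f (f x) = x \<and> f x \<noteq> x" if "x \<in> A" for x
  proof (cases "x \<in> B")
    case True
    then show ?thesis using 1[OF True] B(1) by (auto simp: f_def)
  next
    case False
    then have x: "x \<in> A - B" using that by simp
    then show ?thesis using 2[OF x] B(1) False by (auto simp: f_def)
  qed
  then show ?thesis unfolding fixed_point_free_involution_on_def by blast
qed

section \<open>A vertex of degree two\<close>

text \<open>Connection to \<open>x\<close> is a 2-colouring of \<open>V\<close> whose colour classes
  are the two trees.\<close>

lemma two_forest_on_conn_iff:
  assumes F: "two_forest_on en V F" and V: "x \<in> V" "p \<in> V" "q \<in> V"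
  shows "conn en F p q \<longleftrightarrow> (conn en F x p \<longleftrightarrow> conn en F x q)"
proof -
  have "conn en F x p \<or> conn en F p q \<or> conn en F x q"
    using F V unfolding two_forest_on_def by blast
  then show ?thesis
    using conn_cong[of en F p q x] conn_trans[of en F p x q] conn_sym[of en F x p] by blast
qed

text \<open>For \<open>Z = {a, b, d, e}\<close> and \<open>t = c\<close> this describes the
  2-forests of the four families at once. The vertex \<open>t\<close> is a parameter because a
  neighbour takes the place of \<open>c\<close> once \<open>c\<close> is removed.\<close>

definition singled_out :: "('e \<Rightarrow> 'v set) \<Rightarrow> 'e set \<Rightarrow> 'v set \<Rightarrow> 'v \<Rightarrow> bool" where
  "singled_out en F Z t \<longleftrightarrow> (\<exists>z\<in>Z. (\<forall>q\<in>Z - {z}. \<not> conn en F z q) \<and> \<not> conn en F z t)"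

text \<open>An odd intersection means that \<open>F\<close> splits the four vertices as one against
  three. Then \<open>t\<close> qualifies iff it is on the side of the three, which distinguishes
  \<open>x\<close> from \<open>y\<close> iff they are separated. Under an even split nobody is
  singled out.\<close>

lemma singled_out_differ_iff:
  assumes F: "two_forest_on en V F" and V: "x \<in> V" "y \<in> V" "{a, b, d, e} \<subseteq> V"
    and dist: "distinct [a, b, d, e]"
  shows "singled_out en F {a, b, d, e} x \<noteq> singled_out en F {a, b, d, e} y \<longleftrightarrow>
    \<not> conn en F x y \<and> odd (card ({a, b, d, e} \<inter> {u \<in> V. conn en F x u}))"
proof -
  define X where "X = conn en F x"
  have X: "conn en F p q \<longleftrightarrow> (X p \<longleftrightarrow> X q)" if "p \<in> V" "q \<in> V" for p q
    unfolding X_def by (rule two_forest_on_conn_iff[OF F V(1) that])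
  have Xx: "X x" by (simp add: X_def)
  have ne: "a \<noteq> b" "a \<noteq> d" "a \<noteq> e" "b \<noteq> d" "b \<noteq> e" "d \<noteq> e"
    "b \<noteq> a" "d \<noteq> a" "e \<noteq> a" "d \<noteq> b" "e \<noteq> b" "e \<noteq> d" using dist by auto
  have mem: "a \<in> V" "b \<in> V" "d \<in> V" "e \<in> V" using V(3) by auto
  have so: "singled_out en F {a, b, d, e} t \<longleftrightarrow>
      X a \<noteq> X b \<and> X a \<noteq> X d \<and> X a \<noteq> X e \<and> X a \<noteq> X t \<or>
      X b \<noteq> X a \<and> X b \<noteq> X d \<and> X b \<noteq> X e \<and> X b \<noteq> X t \<or>
      X d \<noteq> X a \<and> X d \<noteq> X b \<and> X d \<noteq> X e \<and> X d \<noteq> X t \<or>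
      X e \<noteq> X a \<and> X e \<noteq> X b \<and> X e \<noteq> X d \<and> X e \<noteq> X t" if "t \<in> V" for t
    unfolding singled_out_def using ne by (simp add: X mem that insert_Diff_if)
  have "card ({a, b, d, e} \<inter> {u \<in> V. conn en F x u}) =
      of_bool (X a) + of_bool (X b) + of_bool (X d) + of_bool (X e)"
    unfolding X_def[symmetric] using ne mem
    by (cases "X a"; cases "X b"; cases "X d"; cases "X e") simp_all
  then show ?thesis
    unfolding so[OF V(1)] so[OF V(2)] X[OF V(1,2)] using Xx
    by (cases "X a"; cases "X b"; cases "X d"; cases "X e"; cases "X y") simp_all
qed

text \<open>Elements satisfying both properties are counted twice and vanish modulo 2.\<close>

lemma even_card_add_card_iff:
  assumes "finite D"
  shows "even (card {p \<in> D. P p} + card {p \<in> D. Q p}) \<longleftrightarrow> even (card {p \<in> D. P p \<noteq> Q p})"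
proof -
  have card: "card {p \<in> D. R p} = (\<Sum>p\<in>D. of_bool (R p))" for R
    using assms by (simp add: Int_def)
  have "(\<Sum>p\<in>D. of_bool (P p)) + (\<Sum>p\<in>D. of_bool (Q p)) =
      (\<Sum>p\<in>D. of_bool (P p \<noteq> Q p)) + 2 * (\<Sum>p\<in>D. of_bool (P p \<and> Q p) :: nat)"
    unfolding sum_distrib_left sum.distrib[symmetric] by (intro sum.cong) auto
  then show ?thesis unfolding card by simp
qed

text \<open>The tree connects \<open>c\<close> to \<open>a\<close>. In the 2-forest,
  \<open>c\<close> and some other \<open>q\<close> are both separated from the singled-out
  \<open>z\<close>, hence connected to each other. So \<open>c\<close> is isolated in
  neither.\<close>

lemma singled_out_incident_edges:
  assumes TF: "(T, F) \<in> tree_forest_partitions en V E" and V: "c \<in> V" "{a, b, d, e} \<subseteq> V"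
    and Z: "c \<notin> {a, b, d, e}" "distinct [a, b, d, e]" and so: "singled_out en F {a, b, d, e} c"
  shows "(\<exists>g\<in>T. \<exists>x. en g = {c, x} \<and> x \<noteq> c \<and> c \<in> en g) \<and> (\<exists>g\<in>F. \<exists>x. en g = {c, x} \<and> x \<noteq> c \<and> c \<in> en g)"
proof -
  let ?Z = "{a, b, d, e}"
  have T: "tree_on en V T" and F: "two_forest_on en V F"
    using TF by (simp_all add: tree_forest_partitions_def)
  have "conn en T c a" using T V by (simp add: tree_on_def)
  moreover have "a \<noteq> c" using Z(1) by auto
  ultimately have edge_T: "\<exists>g\<in>T. \<exists>x. en g = {c, x} \<and> x \<noteq> c" by (rule conn_imp_incident_edge)
  from so obtain z where z: "z \<in> ?Z" "\<forall>q\<in>?Z - {z}. \<not> conn en F z q" "\<not> conn en F z c"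
    unfolding singled_out_def by (elim bexE conjE)
  obtain q where q: "q \<in> ?Z" "q \<noteq> z"
  proof (cases "z = a")
    case True
    then show ?thesis using that[of b] Z(2) by auto
  next
    case False
    then show ?thesis using that[of a] by auto
  qed
  have "\<not> conn en F z q" using z(2) q by simp
  moreover have "z \<in> V" "q \<in> V" using z(1) q(1) V(2) by (simp_all only: subset_iff)
  ultimately have "conn en F c q"
    using two_forest_on_conn_iff[OF F, of z c q] V(1) z(3) by simp
  moreover have "q \<noteq> c" using q(1) Z(1) by metis
  ultimately have "\<exists>g\<in>F. \<exists>x. en g = {c, x} \<and> x \<noteq> c" by (rule conn_imp_incident_edge)
  with edge_T show ?thesis by auto
qed

text \<open>Reduces the count at \<open>c\<close> to the partitions of \<open>E\<close>, where
  \<open>c\<close> is absent. The hypothesis \<open>cut\<close> isolates the only input from the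
  degrees of the ambient graph.\<close>

lemma even_card_singled_out:
  fixes en :: "'e \<Rightarrow> 'v set"
  assumes E: "finite E" "\<And>g. g \<in> E \<Longrightarrow> en g \<subseteq> V" "\<And>g. g \<in> E \<Longrightarrow> \<exists>s t. en g = {s, t}"
    and c: "c \<notin> V" and xy: "x \<in> V" "y \<in> V" and k: "en k = {c, x}" and l: "en l = {c, y}" "k \<noteq> l"
    and Z: "{a, b, d, e} \<subseteq> V" "distinct [a, b, d, e]"
    and cut: "\<And>T F. (T, F) \<in> tree_forest_partitions en V E \<Longrightarrow> \<not> conn en F x y \<Longrightarrow>
      even (card {g \<in> T. crosses en F g}) \<longleftrightarrow> odd (card ({a, b, d, e} \<inter> {u \<in> V. conn en F x u}))"
  shows "even (card {(T, F) \<in> tree_forest_partitions en (insert c V) (insert k (insert l E)).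
    singled_out en F {a, b, d, e} c})"
proof -
  let ?Z = "{a, b, d, e}" and ?D = "tree_forest_partitions en V E"
  let ?D' = "tree_forest_partitions en (insert c V) (insert k (insert l E))"
  let ?U = "\<lambda>k l. {(T, F) \<in> ?D'. k \<in> T \<and> l \<in> F \<and> singled_out en F ?Z c}"
  have cE: "c \<notin> \<Union> (en ` E)" using E(2) c by blast
  have cZ: "c \<notin> ?Z" using c Z(1) by blast
  \<comment> \<open>Tree and 2-forest each need an edge at \<open>c\<close>, and only
    \<open>k\<close> and \<open>l\<close> are available, so each gets exactly one.\<close>
  have kl: "k \<in> T \<and> l \<in> F \<or> l \<in> T \<and> k \<in> F"
    if TF: "(T, F) \<in> ?D'" "singled_out en F ?Z c" for T F
  proof -
    have P: "T \<union> F = insert k (insert l E)" "T \<inter> F = {}" "tree_on en (insert c V) T"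
      "two_forest_on en (insert c V) F"
      using TF(1) by (auto simp: tree_forest_partitions_def)
    have at_c: "g = k \<or> g = l" if "g \<in> T \<union> F" "c \<in> en g" for g
      using that cE unfolding P(1) by auto
    have "c \<in> insert c V" "?Z \<subseteq> insert c V" using Z(1) by auto
    from singled_out_incident_edges[OF TF(1) this cZ Z(2) TF(2)]
    obtain g h where g: "g \<in> T" "c \<in> en g" and h: "h \<in> F" "c \<in> en h" by blast
    have "g = k \<or> g = l" "h = k \<or> h = l" "g \<noteq> h" using at_c g h P(2) by auto
    then show ?thesis using g(1) h(1) by auto
  qed
  have fin: "finite ?D'" "finite ?D"
    by (simp_all add: finite_tree_forest_partitions E(1))
  have fin_U: "finite (?U k l)" "finite (?U l k)"
    by (rule finite_subset[OF _ fin(1)], blast)+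
  have "{(T, F) \<in> ?D'. singled_out en F ?Z c} = ?U k l \<union> ?U l k"
    using kl by blast
  moreover have "?U k l \<inter> ?U l k = {}"
    by (auto simp: tree_forest_partitions_def)
  ultimately have card_U: "card {(T, F) \<in> ?D'. singled_out en F ?Z c} = card (?U k l) + card (?U l k)"
    using card_Un_disjoint[OF fin_U] by simp
  \<comment> \<open>The leaf \<open>c\<close> is represented by its neighbour \<open>u\<close> in
    the 2-forest, and connections among the four vertices are unchanged.\<close>
  have so: "singled_out en (insert g F) ?Z c \<longleftrightarrow> singled_out en F ?Z u"
    if "(T, F) \<in> ?D" "en g = {c, u}" "u \<in> V" for T F g u
  proof -
    have "F \<subseteq> E" using that(1) by (auto simp: tree_forest_partitions_def)
    then have "c \<notin> \<Union> (en ` F)" using cE by auto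
    moreover have "u \<noteq> c" using that c by auto
    ultimately have conn: "conn en (insert g F) p q \<longleftrightarrow>
        conn en F (if p = c then u else p) (if q = c then u else q)" for p q
      using conn_attach_leaf[of c en F g u] that(2) by blast
    have Z_conn: "conn en (insert g F) z q \<longleftrightarrow> conn en F z q" if "z \<in> ?Z" "q \<in> ?Z" for z q
      unfolding conn using that cZ by metis
    have c_conn: "conn en (insert g F) z c \<longleftrightarrow> conn en F z u" if "z \<in> ?Z" for z
      unfolding conn using that cZ by metis
    show ?thesis
      unfolding singled_out_def by (intro bex_cong refl conj_cong ball_cong) (simp_all add: Z_conn c_conn)
  qed
  have "card (?U k l) = card {(T, F) \<in> ?D. singled_out en (insert l F) ?Z c}"
    by (rule card_partitions_attach_leaf[OF cE c xy k l])
  also have "{(T, F) \<in> ?D. singled_out en (insert l F) ?Z c} = {p \<in> ?D. singled_out en (snd p) ?Z y}"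
    using so[OF _ l(1) xy(2)] by auto
  finally have U1: "card (?U k l) = card {p \<in> ?D. singled_out en (snd p) ?Z y}" .
  have "card (?U l k) = card {(T, F) \<in> ?D. singled_out en (insert k F) ?Z c}"
    using card_partitions_attach_leaf[OF cE c xy(2,1) l(1) k l(2)[symmetric]]
    by (simp only: insert_commute[of l k])
  also have "{(T, F) \<in> ?D. singled_out en (insert k F) ?Z c} = {p \<in> ?D. singled_out en (snd p) ?Z x}"
    using so[OF _ k xy(1)] by auto
  finally have U2: "card (?U l k) = card {p \<in> ?D. singled_out en (snd p) ?Z x}" .
  have differ: "singled_out en F ?Z y \<noteq> singled_out en F ?Z x \<longleftrightarrow>
      \<not> conn en F x y \<and> even (card {g \<in> T. crosses en F g})" if "(T, F) \<in> ?D" for T F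
  proof -
    have "two_forest_on en V F" using that by (auto simp: tree_forest_partitions_def)
    from singled_out_differ_iff[OF this xy Z] cut[OF that] show ?thesis by blast
  qed
  have "{p \<in> ?D. singled_out en (snd p) ?Z y \<noteq> singled_out en (snd p) ?Z x} =
      {(T, F) \<in> ?D. \<not> conn en F x y \<and> even (card {g \<in> T. crosses en F g})}"
    (is "?L = ?R")
  proof (rule set_eqI)
    fix p :: "'e set \<times> 'e set"
    obtain T F where "p = (T, F)" by force
    then show "p \<in> ?L \<longleftrightarrow> p \<in> ?R" using differ[of T F] by (cases "(T, F) \<in> ?D") simp_all
  qed
  then show ?thesis
    unfolding card_U U1 U2 even_card_add_card_iff[OF fin(2)]
    using even_separating_partitions[OF E xy] by simp
qed

section \<open>Counting cut edges in the 4-regular graph\<close>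

lemma neighbours_subset_verts: "finite_multigraph G \<Longrightarrow> neighbours G u \<subseteq> verts G"
  by (auto simp: neighbours_def adjacent_def finite_multigraph_def)

lemma card_star_cut:
  assumes h: "bij_betw h N {g \<in> edges G. u \<in> ends G g}" "\<And>z. z \<in> N \<Longrightarrow> ends G (h z) = {u, z}"
    and u: "u \<notin> A"
  shows "card {g \<in> edges G. u \<in> ends G g \<and> cuts (ends G) A g} = card (N \<inter> A)"
proof -
  have cut: "cuts (ends G) A (h z) \<longleftrightarrow> z \<in> A" if "z \<in> N" for z
    using h(2)[OF that] u by (simp add: cuts_def)
  have "{g \<in> edges G. u \<in> ends G g \<and> cuts (ends G) A g} = {g \<in> h ` N. cuts (ends G) A g}"
    using h(1) by (auto simp: bij_betw_def)
  also have "\<dots> = h ` (N \<inter> A)" using cut by auto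
  finally show ?thesis
    using h(1) by (metis bij_betw_def card_image inf_le1 inj_on_subset)
qed

theorem mainTheorem4:
  fixes G S :: "('v, 'e) multigraph" and v w a b c d e :: 'v
  assumes "finite_multigraph G" and "is_connected G" and "regular 4 G"
    and "v \<in> verts G" and "w \<in> verts G" and "adjacent G v w"
    and "card (neighbours G v \<inter> neighbours G w) = 1"
    and "distinct [v, w, a, b, c, d, e]"
    and "neighbours G w = {v, a, b, c}" and "neighbours G v = {w, c, d, e}"
    and "S = delete_verts G {v, w}"
  shows "(\<exists>\<iota>. fixed_point_free_involution_on
            (tree_forest_pairs S {a} {b, c, d, e} \<union> tree_forest_pairs S {b} {a, c, d, e} \<union>
             tree_forest_pairs S {d} {a, b, c, e} \<union> tree_forest_pairs S {e} {a, b, c, d}) \<iota>) \<and>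
         (num_tree_forest_pairs S {a} {b, c, d, e} + num_tree_forest_pairs S {b} {a, c, d, e} +
          num_tree_forest_pairs S {d} {a, b, c, e} + num_tree_forest_pairs S {e} {a, b, c, d})
           mod 2 = 0"
proof -
  note G = assms(1)
  let ?en = "ends G" and ?Z = "{a, b, d, e}"
  let ?D = "tree_forest_partitions ?en (verts S) (edges S)"
  let ?Q = "\<lambda>z. insert c ?Z - {z}"
  let ?U = "{(T, F) \<in> ?D. singled_out ?en F ?Z c}"
  have vw: "v \<noteq> w" "v \<notin> insert c ?Z" "w \<notin> insert c ?Z" and cZ: "c \<notin> ?Z" and Z: "distinct [a, b, d, e]"
    using assms(8) by auto
  have S: "verts S = verts G - {v, w}" "edges S = {g \<in> edges G. ?en g \<inter> {v, w} = {}}" "ends S = ?en"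
    using assms(11) by (simp_all add: delete_verts_def)
  have inV: "insert c ?Z \<subseteq> verts S"
    using neighbours_subset_verts[OF G, of v] neighbours_subset_verts[OF G, of w] vw
    unfolding S assms(9,10) by auto
  have edge: "?en g \<subseteq> verts G" "\<exists>s t. ?en g = {s, t}" if "g \<in> edges G" for g
  proof -
    show "?en g \<subseteq> verts G" using that G by (auto simp: finite_multigraph_def)
    have "card (?en g) = 1 \<or> card (?en g) = 2" using that G by (auto simp: finite_multigraph_def)
    then show "\<exists>s t. ?en g = {s, t}" by (auto simp: card_1_singleton_iff card_2_iff)
  qed
  have fin: "finite (edges S)" "finite ?D"
    using G finite_tree_forest_partitions[of "edges S"] by (auto simp: finite_multigraph_def S)
  have deg: "degree G u = 4" if "u \<in> verts G" for u using assms(3) that by (simp add: regular_def)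
  \<comment> \<open>Four distinct neighbours account for the whole degree 4 at \<open>w\<close>, and
    likewise at \<open>v\<close>.\<close>
  obtain hw where hw: "bij_betw hw {v, a, b, c} {g \<in> edges G. w \<in> ?en g}"
    "\<And>z. z \<in> {v, a, b, c} \<Longrightarrow> ?en (hw z) = {w, z}"
    by (rule simple_star[OF G, of w]) (use deg[OF assms(5)] assms(8,9) in auto)
  obtain hv where hv: "bij_betw hv {w, c, d, e} {g \<in> edges G. v \<in> ?en g}"
    "\<And>z. z \<in> {w, c, d, e} \<Longrightarrow> ?en (hv z) = {v, z}"
    by (rule simple_star[OF G, of v]) (use deg[OF assms(4)] assms(8,10) in auto)

  have even_U: "even (card ?U)"
  proof (cases "?U = {}")
    case True
    then show ?thesis by (simp only: card.empty even_zero)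
  next
    case False
    then obtain \<psi> \<phi> where "(\<psi>, \<phi>) \<in> ?D" "singled_out ?en \<phi> ?Z c" by blast
    moreover from this have "\<psi> \<union> \<phi> = edges S" "\<psi> \<inter> \<phi> = {}"
      by (simp_all add: tree_forest_partitions_def)
    moreover have "c \<in> verts S" "?Z \<subseteq> verts S" using inV by simp_all
    \<comment> \<open>A relevant pair has an edge of its tree and an edge of its 2-forest at
      \<open>c\<close>, which gives two different edges of \<open>S\<close> there. Their other ends
      \<open>x\<close> and \<open>y\<close> may coincide.\<close>
    ultimately obtain k x l y where k: "k \<in> edges S" "?en k = {c, x}" "x \<noteq> c"
      and l: "l \<in> edges S" "?en l = {c, y}" "y \<noteq> c" and kl: "k \<noteq> l"
      using singled_out_incident_edges[of \<psi> \<phi> ?en "verts S" "edges S" c a b d e] cZ Z by blast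
    let ?V = "verts S - {c}" and ?E = "{g \<in> edges S. c \<notin> ?en g}"
    \<comment> \<open>The edges from \<open>c\<close> to \<open>w\<close> and \<open>v\<close>
      together with \<open>k\<close> and \<open>l\<close> use up the degree 4 of
      \<open>c\<close>.\<close>
    have at_c: "{g \<in> edges G. c \<in> ?en g} = {hw c, hv c, k, l}"
    proof -
      have hc: "hw c \<in> edges G" "?en (hw c) = {w, c}" "hv c \<in> edges G" "?en (hv c) = {v, c}"
        using hw hv by (auto simp: bij_betw_def)
      have "hw c \<noteq> hv c" using hc vw by (metis doubleton_eq_iff)
      moreover have "hw c \<notin> {k, l}" "hv c \<notin> {k, l}" using hc k(1) l(1) by (auto simp: S)
      ultimately have "card {hw c, hv c, k, l} = 4" using kl by simp
      moreover have "card {g \<in> edges G. c \<in> ?en g} \<le> 4"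
        using deg[of c] inV by (auto simp: degree_def S)
      moreover have "{hw c, hv c, k, l} \<subseteq> {g \<in> edges G. c \<in> ?en g}"
        using hc k l by (auto simp: S)
      moreover have "finite {g \<in> edges G. c \<in> ?en g}" using G by (simp add: finite_multigraph_def)
      ultimately show ?thesis using card_seteq by metis
    qed
    have E_S: "edges S = insert k (insert l ?E)"
    proof
      have not_S: "hw c \<notin> edges S" "hv c \<notin> edges S" using hw(2)[of c] hv(2)[of c] by (auto simp: S)
      show "edges S \<subseteq> insert k (insert l ?E)"
      proof
        fix g assume g: "g \<in> edges S"
        show "g \<in> insert k (insert l ?E)"
        proof (cases "c \<in> ?en g")
          case True
          then have "g \<in> {hw c, hv c, k, l}" using g unfolding at_c[symmetric] S(2) by simp
          then show ?thesis using g not_S by auto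
        qed (use g in simp)
      qed
    qed (use k l in auto)
    have V_S: "verts S = insert c ?V" using inV by auto
    have ES: "?en g \<subseteq> verts S" if "g \<in> edges S" for g using that edge(1)[of g] by (auto simp: S)
    have xy: "x \<in> ?V" "y \<in> ?V" using ES[OF k(1)] ES[OF l(1)] k l by auto
    \<comment> \<open>Let \<open>A\<close> be the side of \<open>x\<close>. Its cut in
      \<open>G\<close> is even and consists of the crossing edges of \<open>T\<close>, the edge
      \<open>k\<close> (but not \<open>l\<close>), and one edge from \<open>w\<close> or
      \<open>v\<close> to each of \<open>a\<close>, \<open>b\<close>, \<open>d\<close>,
      \<open>e\<close> in \<open>A\<close>. The single edge \<open>k\<close> makes the other two
      numbers have opposite parity.\<close>
    have cut: "even (card {g \<in> T. crosses ?en F g}) \<longleftrightarrow> odd (card (?Z \<inter> {u \<in> ?V. conn ?en F x u}))"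
      if TF: "(T, F) \<in> tree_forest_partitions ?en ?V ?E" and sep: "\<not> conn ?en F x y" for T F
    proof -
      define A where "A = {u \<in> ?V. conn ?en F x u}"
      let ?I = "\<lambda>u. {g \<in> edges G. u \<in> ?en g \<and> cuts ?en A g}"
      have P: "T \<union> F = ?E" "T \<inter> F = {}" "two_forest_on ?en ?V F"
        using TF by (auto simp: tree_forest_partitions_def)
      have A: "v \<notin> A" "w \<notin> A" "c \<notin> A" "x \<in> A" "y \<notin> A"
        using xy sep by (simp_all add: S A_def)
      have cross: "crosses ?en F g \<longleftrightarrow> cuts ?en A g" if "g \<in> ?E" for g
      proof -
        have "g \<in> edges S" "c \<notin> ?en g" using that by simp_all
        then have gV: "?en g \<subseteq> ?V" and gG: "g \<in> edges G" using ES[of g] S(2) by auto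
        obtain s t where "?en g = {s, t}" using edge(2)[OF gG] by (elim exE)
        then show ?thesis unfolding A_def using gV by (rule crosses_iff_cuts[OF P(3) xy(1)])
      qed
      have "\<not> crosses ?en F g" if "g \<in> F" for g
        using conn_edge[OF that] by (auto simp: crosses_def)
      then have E_cut: "{g \<in> ?E. cuts ?en A g} = {g \<in> T. crosses ?en F g}"
        using cross P(1) by auto
      have kl_cut: "cuts ?en A k" "\<not> cuts ?en A l"
        using A unfolding cuts_def k(2) l(2) by simp_all
      have S_cut: "{g \<in> edges S. cuts ?en A g} = insert k {g \<in> T. crosses ?en F g}"
        unfolding E_cut[symmetric] using kl_cut E_S by auto
      have "k \<notin> T" using k(2) P(1) by auto
      moreover have "finite T" using P(1) fin(1) by (auto intro: finite_subset)
      ultimately have card_S: "card {g \<in> edges S. cuts ?en A g} = Suc (card {g \<in> T. crosses ?en F g})"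
        unfolding S_cut by (intro card_insert_disjoint) auto
      have split: "{g \<in> edges G. cuts ?en A g} = (?I w \<union> ?I v) \<union> {g \<in> edges S. cuts ?en A g}"
        by (auto simp: S)
      \<comment> \<open>An edge in both stars would join \<open>v\<close> to \<open>w\<close>, and
        both of these lie outside \<open>A\<close>.\<close>
      have no_vw: "?I w \<inter> ?I v = {}"
      proof -
        have False if g: "g \<in> edges G" "w \<in> ?en g" "v \<in> ?en g" "cuts ?en A g" for g
        proof -
          obtain s t where "?en g = {s, t}" using edge(2)[OF g(1)] by blast
          then have "?en g = {v, w}" using g(2,3) vw(1) by auto
          moreover have "{v, w} \<inter> A = {}"
            using A(1,2) by (simp only: Int_insert_left if_False Int_empty_left)
          ultimately have "?en g \<inter> A = {}" by (simp only:)
          then show False using g(4) unfolding cuts_def by simp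
        qed
        then show ?thesis by blast
      qed
      have finG: "finite (edges G)" using G by (simp add: finite_multigraph_def)
      have "card {g \<in> edges G. cuts ?en A g} = card (?I w) + card (?I v) + card {g \<in> edges S. cuts ?en A g}"
        unfolding split using finG no_vw by (subst card_Un_disjoint; auto simp: S card_Un_disjoint)
      moreover have "card (?I w) = card ({a, b} \<inter> A)"
      proof -
        have "{v, a, b, c} \<inter> A = {a, b} \<inter> A" using A(1,3) by blast
        then show ?thesis using card_star_cut[OF hw A(2)] by (simp only:)
      qed
      moreover have "card (?I v) = card ({d, e} \<inter> A)"
      proof -
        have "{w, c, d, e} \<inter> A = {d, e} \<inter> A" using A(2,3) by blast
        then show ?thesis using card_star_cut[OF hv A(1)] by (simp only:)
      qed
      moreover have "card (?Z \<inter> A) = card ({a, b} \<inter> A) + card ({d, e} \<inter> A)"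
      proof -
        have "?Z \<inter> A = ({a, b} \<inter> A) \<union> ({d, e} \<inter> A)" by blast
        moreover have "({a, b} \<inter> A) \<inter> ({d, e} \<inter> A) = {}" using Z by auto
        ultimately show ?thesis using card_Un_disjoint[of "{a, b} \<inter> A" "{d, e} \<inter> A"] by simp
      qed
      moreover have "even (card {g \<in> edges G. cuts ?en A g})"
        by (rule even_card_cut[OF G]) (auto simp: deg S A_def)
      ultimately show ?thesis unfolding card_S A_def[symmetric] by simp
    qed
    have sub: "?Z \<subseteq> ?V" using inV cZ by auto
    have finE: "finite ?E" using fin(1) by simp
    have EV: "?en g \<subseteq> ?V" if "g \<in> ?E" for g using ES[of g] that by blast
    have Ends: "\<exists>s t. ?en g = {s, t}" if "g \<in> ?E" for g
      using that unfolding S(2) by (intro edge(2)) simp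
    have "c \<notin> ?V" by simp
    from even_card_singled_out[OF finE EV Ends this xy k(2) l(2) kl sub Z cut]
    show ?thesis unfolding E_S[symmetric] V_S[symmetric] .
  qed

  have pairs: "tree_forest_pairs S {z} (?Q z) = {(T, F) \<in> ?D. \<forall>q\<in>?Q z. \<not> conn ?en F z q}"
    if "z \<in> ?Z" for z
  proof -
    have "z \<in> verts S" using that inV by blast
    moreover have "?Q z \<subseteq> verts S" using inV by blast
    moreover have "?Q z \<noteq> {}" using that cZ by blast
    ultimately show ?thesis unfolding S(3)[symmetric] by (rule tree_forest_pairs_eq)
  qed
  have Q: "{b, c, d, e} = ?Q a" "{a, c, d, e} = ?Q b" "{a, b, c, e} = ?Q d" "{a, b, c, d} = ?Q e"
    using assms(8) by auto
  let ?X = "\<lambda>z. tree_forest_pairs S {z} (?Q z)"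
  \<comment> \<open>The singled-out vertex is the index of the family, so its existential quantifier
    becomes the union.\<close>
  have union: "(\<Union>z\<in>?Z. ?X z) = ?U"
  proof -
    have "?Q z = insert c (?Z - {z})" if "z \<in> ?Z" for z using that cZ by blast
    then have X: "?X z = {(T, F) \<in> ?D. (\<forall>q\<in>?Z - {z}. \<not> conn ?en F z q) \<and> \<not> conn ?en F z c}" if "z \<in> ?Z" for z
      using pairs[OF that] that by (simp only: ball_simps) blast
    have UN: "(\<Union>z\<in>Z. {(T, F) \<in> D. R z F}) = {(T, F) \<in> D. \<exists>z\<in>Z. R z F}"
      for Z :: "'v set" and D :: "('e set \<times> 'e set) set" and R :: "'v \<Rightarrow> 'e set \<Rightarrow> bool"
      by auto
    show ?thesis unfolding singled_out_def UN[symmetric] using X by (intro SUP_cong refl)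
  qed
  have "card (\<Union>z\<in>?Z. ?X z) = (\<Sum>z\<in>?Z. card (?X z))"
  proof (rule card_UN_disjoint)
    show "\<forall>z\<in>?Z. finite (?X z)"
      using union fin(2) by (auto intro: finite_subset[of _ ?D] simp: pairs)
    \<comment> \<open>A pair in two families would have \<open>z\<close>, \<open>z'\<close> and
      \<open>c\<close> pairwise separated, which is impossible with two components.\<close>
    show "\<forall>z\<in>?Z. \<forall>z'\<in>?Z. z \<noteq> z' \<longrightarrow> ?X z \<inter> ?X z' = {}"
    proof (intro ballI impI)
      fix z z' assume z: "z \<in> ?Z" "z' \<in> ?Z" "z \<noteq> z'"
      have False if "(T, F) \<in> ?X z" "(T, F) \<in> ?X z'" for T F
      proof -
        have "two_forest_on ?en (verts S) F" "\<not> conn ?en F z z'" "\<not> conn ?en F z c" "\<not> conn ?en F z' c"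
          using that z cZ unfolding pairs[OF z(1)] pairs[OF z(2)] tree_forest_partitions_def by auto
        then show False
          using two_forest_on_conn_iff[of ?en "verts S" F c z z'] conn_sym[of ?en F c] z inV by blast
      qed
      then show "?X z \<inter> ?X z' = {}" by auto
    qed
  qed simp
  then have "card ?U = card (?X a) + card (?X b) + card (?X d) + card (?X e)"
    unfolding union using Z by simp
  moreover have "?U = ?X a \<union> ?X b \<union> ?X d \<union> ?X e" unfolding union[symmetric] by blast
  moreover have "finite ?U" using fin(2) by (auto intro: finite_subset[of _ ?D])
  ultimately show ?thesis
    using even_U fixed_point_free_involution_if_even[of ?U]
    unfolding num_tree_forest_pairs_def Q by (simp add: even_iff_mod_2_eq_zero)
qed

end
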